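(* Let $X$ be a Priestley space. Then $(\mathsf{CC}(X),\unlhd)$ is a bi-Esakia space iff $X$ is a co-Esakia space.
   Context: A Priestley space is a compact space with a partial order such that $x\not\le y$ implies a clopen upset containing $x$ but not $y$. It is an Esakia space if ${\downarrow}V$ is clopen for every clopen $V$, a co-Esakia space if ${\uparrow}V$ is clopen for every clopen $V$, and a bi-Esakia space if both. $\mathsf{CC}(X)$ is the set of nonempty closed chains of $X$ with topology generated by $\Box V=\{C\mid C\subseteq V\}$, $\Diamond V=\{C\mid C\cap V\ne\varnothing\}$ ($V$ clopen in $X$) and order $C_1\unlhd C_2$ iff $C_2\subseteq C_1$ and $C_2$ is an upset of $C_1$. *)

theory Defs
  imports "HOL-Analysis.Analysis"
begin

text \<open>
  A partially ordered topological space is a topology \<open>X\<close> together with a relation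
  \<open>r \<subseteq> topspace X \<times> topspace X\<close>, where \<open>(x, y) \<in> r\<close> reads \<open>x \<le> y\<close>.  Thus \<open>r `` V\<close> is the
  upset and \<open>r\<inverse> `` V\<close> the downset generated by \<open>V\<close>.
\<close>

definition clopenin :: "'a topology \<Rightarrow> 'a set \<Rightarrow> bool"
  where "clopenin X V \<longleftrightarrow> closedin X V \<and> openin X V"

definition upset_of :: "'a rel \<Rightarrow> 'a set \<Rightarrow> 'a set \<Rightarrow> bool"
  where "upset_of r A U \<longleftrightarrow> U \<subseteq> A \<and> (\<forall>x\<in>U. \<forall>y\<in>A. (x, y) \<in> r \<longrightarrow> y \<in> U)"

definition priestley_space :: "'a topology \<Rightarrow> 'a rel \<Rightarrow> bool"
  where "priestley_space X r \<longleftrightarrow>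
    compact_space X \<and> partial_order_on (topspace X) r \<and>
    (\<forall>x\<in>topspace X. \<forall>y\<in>topspace X. (x, y) \<notin> r \<longrightarrow>
      (\<exists>U. clopenin X U \<and> upset_of r (topspace X) U \<and> x \<in> U \<and> y \<notin> U))"

definition esakia_space :: "'a topology \<Rightarrow> 'a rel \<Rightarrow> bool"
  where "esakia_space X r \<longleftrightarrow>
    priestley_space X r \<and> (\<forall>V. clopenin X V \<longrightarrow> clopenin X (r\<inverse> `` V))"

definition co_esakia_space :: "'a topology \<Rightarrow> 'a rel \<Rightarrow> bool"
  where "co_esakia_space X r \<longleftrightarrow>
    priestley_space X r \<and> (\<forall>V. clopenin X V \<longrightarrow> clopenin X (r `` V))"

definition bi_esakia_space :: "'a topology \<Rightarrow> 'a rel \<Rightarrow> bool"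
  where "bi_esakia_space X r \<longleftrightarrow> esakia_space X r \<and> co_esakia_space X r"

definition CC :: "'a topology \<Rightarrow> 'a rel \<Rightarrow> 'a set set"
  where "CC X r = {C. C \<noteq> {} \<and> closedin X C \<and> C \<in> Chains r}"

definition CC_box :: "'a topology \<Rightarrow> 'a rel \<Rightarrow> 'a set \<Rightarrow> 'a set set"
  where "CC_box X r V = {C \<in> CC X r. C \<subseteq> V}"

definition CC_diamond :: "'a topology \<Rightarrow> 'a rel \<Rightarrow> 'a set \<Rightarrow> 'a set set"
  where "CC_diamond X r V = {C \<in> CC X r. C \<inter> V \<noteq> {}}"

text \<open>
  The underlying set of a generated topology is the union of its subbasis; here it is
  \<open>CC X r\<close>, the box of the clopen set \<open>topspace X\<close>.
\<close>

definition CC_topology :: "'a topology \<Rightarrow> 'a rel \<Rightarrow> 'a set topology"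
  where "CC_topology X r = topology_generated_by
    ({CC_box X r V |V. clopenin X V} \<union> {CC_diamond X r V |V. clopenin X V})"

definition CC_order :: "'a topology \<Rightarrow> 'a rel \<Rightarrow> 'a set rel"
  where "CC_order X r = {(C1, C2). C1 \<in> CC X r \<and> C2 \<in> CC X r \<and> C2 \<subseteq> C1 \<and> upset_of r C1 C2}"

lemma topspace_CC_topology: "topspace (CC_topology X r) = CC X r"
proof -
  have "CC_box X r (topspace X) = CC X r"
    by (auto simp: CC_box_def CC_def dest: closedin_subset)
  moreover have "clopenin X (topspace X)"
    by (simp add: clopenin_def)
  moreover have "CC_box X r V \<subseteq> CC X r" "CC_diamond X r V \<subseteq> CC X r" for V
    by (auto simp: CC_box_def CC_diamond_def)
  ultimately show ?thesis
    unfolding CC_topology_def topology_generated_by_topspace by blast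
qed

end

theory Submission
  imports Defs
begin

text \<open>
  \<open>CC(X)\<close> is compact by Alexander's lemma: given a subbasic cover without a finite subcover,
  Tychonoff's theorem yields a chain with a point outside each box of the cover and missing all
  its diamonds, and the closure of that chain is uncovered.  Downsets of open sets are always
  open: if \<open>D\<close> is an upset of \<open>C\<close> with \<open>D \<subseteq> V\<close>, a clopen upset \<open>U\<close> of \<open>X\<close> with \<open>C \<inter> U \<subseteq> V\<close> meeting
  the same sets as \<open>D\<close> replaces \<open>D\<close> by \<open>C' \<inter> U\<close> for all \<open>C'\<close> near \<open>C\<close>.  For upsets, a basic open set
  only constrains the points of \<open>C - D\<close> through finitely many clopen sets \<open>W\<^sub>1, \<dots>, W\<^sub>n\<close>; iterating
  \<open>T \<mapsto> r `` (T \<inter> W\<^sub>i)\<close>, which preserves clopen sets in a co-Esakia space, describes the chains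
  that can be extended below by such points.  Conversely, \<open>y \<in> r `` V\<close> iff \<open>{y}\<close> lies in the upset
  of \<open>\<diamond>V\<close>.
\<close>

section \<open>Priestley spaces\<close>

lemma clopenin_subset: "clopenin X U \<Longrightarrow> U \<subseteq> topspace X"
  by (simp add: clopenin_def closedin_subset)

lemma clopenin_Compl: "clopenin X U \<Longrightarrow> clopenin X (topspace X - U)"
  by (simp add: clopenin_def openin_diff closedin_diff)

lemma clopenin_topspace: "clopenin X (topspace X)"
  by (simp add: clopenin_def)

lemma clopenin_empty: "clopenin X {}"
  by (simp add: clopenin_def)

lemma clopenin_Int: "clopenin X U \<Longrightarrow> clopenin X V \<Longrightarrow> clopenin X (U \<inter> V)"
  by (simp add: clopenin_def openin_Int closedin_Int)

lemma clopenin_Un: "clopenin X U \<Longrightarrow> clopenin X V \<Longrightarrow> clopenin X (U \<union> V)"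
  by (simp add: clopenin_def openin_Un closedin_Un)

lemma clopenin_Diff: "clopenin X U \<Longrightarrow> clopenin X V \<Longrightarrow> clopenin X (U - V)"
  by (simp add: clopenin_def openin_diff closedin_diff)

lemma clopenin_Union: "finite F \<Longrightarrow> (\<And>U. U \<in> F \<Longrightarrow> clopenin X U) \<Longrightarrow> clopenin X (\<Union>F)"
  by (simp add: clopenin_def openin_Union closedin_Union)

lemma upset_of_Union: "(\<And>U. U \<in> F \<Longrightarrow> upset_of r A U) \<Longrightarrow> upset_of r A (\<Union>F)"
  unfolding upset_of_def by blast

lemma priestley_spaceD:
  assumes "priestley_space X r"
  shows "compact_space X"
    and "r \<subseteq> topspace X \<times> topspace X"
    and "x \<in> topspace X \<Longrightarrow> (x, x) \<in> r"
    and "(x, y) \<in> r \<Longrightarrow> (y, z) \<in> r \<Longrightarrow> (x, z) \<in> r"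
    and "(x, y) \<in> r \<Longrightarrow> (y, x) \<in> r \<Longrightarrow> x = y"
  using assms
  unfolding priestley_space_def partial_order_on_def preorder_on_def refl_on_def
  by (auto dest: transD antisymD)

lemma priestley_space_separation:
  assumes "priestley_space X r" "x \<in> topspace X" "y \<in> topspace X" "(x, y) \<notin> r"
  obtains U where "clopenin X U" "upset_of r (topspace X) U" "x \<in> U" "y \<notin> U"
  using assms unfolding priestley_space_def by blast

text \<open>The predicate \<open>Q\<close> carries a side condition, such as being an upset missing
  a point, through the passage to a finite subcover.\<close>

lemma compact_space_clopen_cover:
  assumes "compact_space X" "closedin X K"
    and cover: "\<And>k. k \<in> K \<Longrightarrow> \<exists>U. clopenin X U \<and> Q U \<and> k \<in> U"
  obtains F where "finite F" "\<And>U. U \<in> F \<Longrightarrow> clopenin X U \<and> Q U" "K \<subseteq> \<Union>F"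
proof -
  have "compactin X K"
    using assms closedin_compact_space by blast
  moreover have "K \<subseteq> \<Union>{U. clopenin X U \<and> Q U}"
    using cover by blast
  ultimately obtain F where "finite F" "F \<subseteq> {U. clopenin X U \<and> Q U}" "K \<subseteq> \<Union>F"
    by (metis (no_types, lifting) compactinD clopenin_def mem_Collect_eq)
  then show thesis
    using that by blast
qed

section \<open>Separation of points from closed sets\<close>

text \<open>Each point of \<open>K\<close> lies in a clopen upset missing \<open>y\<close>; finitely
  many of them cover \<open>K\<close>, and their union is again an upset.\<close>

lemma priestley_space_upset_avoiding_point:
  assumes P: "priestley_space X r" and K: "closedin X K" and y: "y \<in> topspace X"
    and "\<And>k. k \<in> K \<Longrightarrow> (k, y) \<notin> r"
  obtains U where "clopenin X U" "upset_of r (topspace X) U" "K \<subseteq> U" "y \<notin> U"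
proof -
  let ?Q = "\<lambda>U. upset_of r (topspace X) U \<and> y \<notin> U"
  have "\<exists>U. clopenin X U \<and> ?Q U \<and> k \<in> U" if "k \<in> K" for k
    using priestley_space_separation[OF P, of k y] assms that closedin_subset[OF K] by blast
  then obtain F where F: "finite F" "\<And>U. U \<in> F \<Longrightarrow> clopenin X U \<and> ?Q U" "K \<subseteq> \<Union>F"
    using compact_space_clopen_cover[OF priestley_spaceD(1)[OF P] K, of ?Q] by metis
  show thesis
  proof (rule that)
    show "clopenin X (\<Union>F)"
      using F by (intro clopenin_Union) auto
    show "upset_of r (topspace X) (\<Union>F)"
      using F(2) by (intro upset_of_Union) auto
  qed (use F in auto)
qed

text \<open>Dually, \<open>K\<close> is covered by complements of clopen upsets containing
  \<open>y\<close>; removing finitely many of them leaves an upset around \<open>y\<close>.\<close>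

lemma priestley_space_upset_avoiding_closed:
  assumes P: "priestley_space X r" and K: "closedin X K" and y: "y \<in> topspace X"
    and "\<And>k. k \<in> K \<Longrightarrow> (y, k) \<notin> r"
  obtains U where "clopenin X U" "upset_of r (topspace X) U" "y \<in> U" "U \<inter> K = {}"
proof -
  let ?Q = "\<lambda>U. upset_of r (topspace X) (topspace X - U) \<and> y \<notin> U"
  have "\<exists>U. clopenin X U \<and> ?Q U \<and> k \<in> U" if k: "k \<in> K" for k
  proof -
    have "k \<in> topspace X"
      using k closedin_subset[OF K] by blast
    then obtain U where U: "clopenin X U" "upset_of r (topspace X) U" "y \<in> U" "k \<notin> U"
      using priestley_space_separation[OF P y] assms k by metis
    moreover have "topspace X - (topspace X - U) = U"
      using clopenin_subset[OF U(1)] by blast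
    ultimately show ?thesis
      using clopenin_Compl[OF U(1)] \<open>k \<in> topspace X\<close> by (intro exI[of _ "topspace X - U"]) auto
  qed
  then obtain F where F: "finite F" "\<And>U. U \<in> F \<Longrightarrow> clopenin X U \<and> ?Q U" "K \<subseteq> \<Union>F"
    using compact_space_clopen_cover[OF priestley_spaceD(1)[OF P] K, of ?Q] by metis
  show thesis
  proof (rule that)
    show "clopenin X (topspace X - \<Union>F)"
      using F by (intro clopenin_Compl clopenin_Union) auto
    show "upset_of r (topspace X) (topspace X - \<Union>F)"
      using F(2) unfolding upset_of_def by blast
  qed (use F y in auto)
qed

text \<open>By antisymmetry one of \<open>(k, y)\<close> and \<open>(y, k)\<close> is outside
  \<open>r\<close> for each \<open>k\<close> in \<open>K\<close>, so a clopen upset or the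
  complement of one contains \<open>k\<close> and misses \<open>y\<close>.\<close>

lemma priestley_space_clopen_superset:
  assumes P: "priestley_space X r" and K: "closedin X K" and y: "y \<in> topspace X" "y \<notin> K"
  obtains N where "clopenin X N" "K \<subseteq> N" "y \<notin> N"
proof -
  have "\<exists>U. clopenin X U \<and> y \<notin> U \<and> k \<in> U" if k: "k \<in> K" for k
  proof (cases "(k, y) \<in> r")
    case False
    then show ?thesis
      using priestley_space_separation[OF P, of k y] y k closedin_subset[OF K] by blast
  next
    case True
    then have "(y, k) \<notin> r"
      using priestley_spaceD(5)[OF P, of k y] y k by blast
    then obtain U where "clopenin X U" "y \<in> U" "k \<notin> U"
      using priestley_space_separation[OF P, of y k] y k closedin_subset[OF K] by blast
    then show ?thesis
      using k closedin_subset[OF K] by (intro exI[of _ "topspace X - U"]) (auto intro: clopenin_Compl)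
  qed
  then obtain F where "finite F" "\<And>U. U \<in> F \<Longrightarrow> clopenin X U \<and> y \<notin> U" "K \<subseteq> \<Union>F"
    using compact_space_clopen_cover[OF priestley_spaceD(1)[OF P] K, of "\<lambda>U. y \<notin> U"] by metis
  then show thesis
    using that[of "\<Union>F"] clopenin_Union[of F] by blast
qed

section \<open>Closed sets derived from the order\<close>

lemma priestley_space_closedin_upset:
  assumes P: "priestley_space X r" and K: "closedin X K"
  shows "closedin X (r `` K)"
proof -
  have "\<exists>T. openin X T \<and> y \<in> T \<and> T \<subseteq> topspace X - r `` K" if y: "y \<in> topspace X - r `` K" for y
  proof -
    obtain U where U: "clopenin X U" "upset_of r (topspace X) U" "K \<subseteq> U" "y \<notin> U"
      using priestley_space_upset_avoiding_point[OF P K, of y] y by blast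
    have "r `` K \<subseteq> U"
      using U(2,3) priestley_spaceD(2)[OF P] unfolding upset_of_def by blast
    then show ?thesis
      using U clopenin_Compl[OF U(1)] y unfolding clopenin_def by blast
  qed
  then have "openin X (topspace X - r `` K)"
    by (subst openin_subopen) blast
  then show ?thesis
    using priestley_spaceD(2)[OF P] by (auto simp: closedin_def)
qed

lemma priestley_space_closedin_downset:
  assumes P: "priestley_space X r" and K: "closedin X K"
  shows "closedin X (r\<inverse> `` K)"
proof -
  have "\<exists>T. openin X T \<and> y \<in> T \<and> T \<subseteq> topspace X - r\<inverse> `` K"
    if y: "y \<in> topspace X - r\<inverse> `` K" for y
  proof -
    obtain U where U: "clopenin X U" "upset_of r (topspace X) U" "y \<in> U" "U \<inter> K = {}"
      using priestley_space_upset_avoiding_closed[OF P K, of y] y by blast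
    have "U \<inter> r\<inverse> `` K = {}"
      using U(2,4) priestley_spaceD(2)[OF P] unfolding upset_of_def by blast
    then show ?thesis
      using U clopenin_subset[OF U(1)] unfolding clopenin_def by blast
  qed
  then have "openin X (topspace X - r\<inverse> `` K)"
    by (subst openin_subopen) blast
  then show ?thesis
    using priestley_spaceD(2)[OF P] by (auto simp: closedin_def)
qed

text \<open>A clopen upset \<open>U\<close> with \<open>x\<close> inside and \<open>y\<close>
  outside makes \<open>U \<times> (topspace X - U)\<close> a neighbourhood of \<open>(x, y)\<close>
  disjoint from \<open>r\<close>.\<close>

lemma priestley_space_closedin_order:
  assumes P: "priestley_space X r"
  shows "closedin (prod_topology X X) r"
proof -
  let ?S = "topspace X \<times> topspace X"
  have "\<exists>T. openin (prod_topology X X) T \<and> z \<in> T \<and> T \<subseteq> ?S - r" if z: "z \<in> ?S - r" for z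
  proof -
    obtain x y where xy: "z = (x, y)" "x \<in> topspace X" "y \<in> topspace X" "(x, y) \<notin> r"
      using z by blast
    then obtain U where U: "clopenin X U" "upset_of r (topspace X) U" "x \<in> U" "y \<notin> U"
      using priestley_space_separation[OF P] by blast
    have "openin (prod_topology X X) (U \<times> (topspace X - U))"
      using U(1) clopenin_Compl[OF U(1)] by (auto simp: clopenin_def openin_prod_Times_iff)
    moreover have "U \<times> (topspace X - U) \<subseteq> ?S - r"
      using U(2) unfolding upset_of_def by blast
    ultimately show ?thesis
      using xy U by blast
  qed
  then have "openin (prod_topology X X) (?S - r)"
    by (subst openin_subopen) blast
  then show ?thesis
    using priestley_spaceD(2)[OF P] by (simp add: closedin_def)
qed

text \<open>Serves to make finite sets closed, hence finite nonempty chains members of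
  \<open>CC X r\<close>.\<close>

lemma priestley_space_t1: "priestley_space X r \<Longrightarrow> t1_space X"
  unfolding t1_space_def
proof (intro ballI impI)
  fix x y
  assume P: "priestley_space X r" and "x \<in> topspace X" "y \<in> topspace X" "x \<noteq> y"
  then consider "(x, y) \<notin> r" | "(y, x) \<notin> r"
    using priestley_spaceD(5)[OF P] by blast
  then show "\<exists>U. openin X U \<and> x \<in> U \<and> y \<notin> U"
  proof cases
    case 1
    then show ?thesis
      using priestley_space_separation[OF P] \<open>x \<in> topspace X\<close> \<open>y \<in> topspace X\<close>
      by (metis clopenin_def)
  next
    case 2
    then obtain U where "clopenin X U" "y \<in> U" "x \<notin> U"
      using priestley_space_separation[OF P] \<open>x \<in> topspace X\<close> \<open>y \<in> topspace X\<close> by metis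
    then show ?thesis
      using \<open>x \<in> topspace X\<close> clopenin_Compl[of X U] by (auto simp: clopenin_def)
  qed
qed

lemma priestley_space_closedin_finite:
  "priestley_space X r \<Longrightarrow> finite S \<Longrightarrow> S \<subseteq> topspace X \<Longrightarrow> closedin X S"
  using priestley_space_t1 t1_space_closedin_finite by blast

lemma finite_chain_has_greatest:
  assumes "finite S" "S \<noteq> {}" "S \<in> Chains r" "trans r"
  obtains m where "m \<in> S" "\<And>s. s \<in> S \<Longrightarrow> (s, m) \<in> r"
proof -
  have "\<exists>m\<in>S. \<forall>s\<in>S. (s, m) \<in> r"
    using assms(1-3)
  proof (induction rule: finite_ne_induct)
    case (singleton x)
    then show ?case
      by (auto simp: Chains_def)
  next
    case (insert x F)
    then obtain m where m: "m \<in> F" "\<forall>s\<in>F. (s, m) \<in> r"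
      by (auto simp: Chains_def)
    have "(x, m) \<in> r \<or> (m, x) \<in> r" "(x, x) \<in> r"
      using insert.prems m by (auto simp: Chains_def)
    then show ?case
      using m \<open>trans r\<close> by (metis insert_iff transD)
  qed
  then show thesis
    using that by blast
qed

text \<open>The elements of \<open>C\<close> below a given \<open>c\<close> form a closed set, and
  finite nonempty subsets of a chain have a least element, so these sets have the finite
  intersection property; a common point is the minimum.\<close>

lemma CC_has_least:
  assumes P: "priestley_space X r" and C: "C \<in> CC X r"
  obtains m where "m \<in> C" "\<And>c. c \<in> C \<Longrightarrow> (m, c) \<in> r"
proof -
  have C': "C \<noteq> {}" "closedin X C" "C \<in> Chains r" "C \<subseteq> topspace X"
    using C closedin_subset[of X C] by (auto simp: CC_def)
  let ?D = "\<lambda>c. C \<inter> r\<inverse> `` {c}"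
  have "\<Inter>(?D ` C) \<noteq> {}"
  proof (rule compact_space_fip[THEN iffD1, rule_format, OF priestley_spaceD(1)[OF P]], intro conjI ballI allI impI)
    fix K assume "K \<in> ?D ` C"
    then obtain c where c: "c \<in> C" "K = ?D c"
      by blast
    have "closedin X {c}"
      using c C' by (intro priestley_space_closedin_finite[OF P]) auto
    then show "closedin X K"
      unfolding c using C' by (intro closedin_Int priestley_space_closedin_downset[OF P])
  next
    fix F assume F: "finite F \<and> F \<subseteq> ?D ` C"
    then obtain S where S: "finite S" "S \<subseteq> C" "F = ?D ` S"
      by (meson finite_subset_image)
    show "\<Inter>F \<noteq> {}"
    proof (cases "S = {}")
      case False
      \<comment> \<open>For the converse relation, the greatest element of a finite chain is the
        least one for \<open>r\<close>.\<close>
      have "S \<in> Chains (r\<inverse>)"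
        using S(2) C'(3) by (simp add: Chains_def subset_iff)
      moreover have "trans (r\<inverse>)"
        using priestley_spaceD(4)[OF P] by (auto intro: transI)
      ultimately obtain m where "m \<in> S" "\<And>s. s \<in> S \<Longrightarrow> (s, m) \<in> r\<inverse>"
        using finite_chain_has_greatest[OF S(1) False] by metis
      then have "m \<in> \<Inter>F"
        using S by auto
      then show ?thesis
        by blast
    qed (use S in auto)
  qed
  then obtain m where "m \<in> \<Inter>(?D ` C)"
    by blast
  then show thesis
    using that[of m] C'(1) by auto
qed

section \<open>The space of closed chains\<close>

text \<open>Brings the inductively generated topology into the form in which Alexander's subbase
  lemma is stated.\<close>

lemma topology_generated_by_eq_subbase:
  "topology_generated_by B =
    topology (arbitrary union_of (finite intersection_of (\<lambda>x. x \<in> B) relative_to \<Union>B))"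
proof -
  let ?T = "arbitrary union_of (finite intersection_of (\<lambda>x. x \<in> B) relative_to \<Union>B)"
  have "generate_topology_on B S \<longleftrightarrow> ?T S" for S
  proof
    assume "generate_topology_on B S"
    then show "?T S"
    proof (rule generate_topology_on_coarsest[rotated 2])
      show "istopology ?T"
        by (rule istopology_subbase)
      fix S assume "S \<in> B"
      then have "(finite intersection_of (\<lambda>x. x \<in> B) relative_to \<Union>B) S"
        by (auto simp: relative_to_def intersection_of_def intro!: exI[of _ S] exI[of _ "{S}"])
      then show "?T S"
        by (rule arbitrary_union_of_inc)
    qed
  next
    assume "?T S"
    then obtain \<U> where \<U>: "\<And>U. U \<in> \<U> \<Longrightarrow> (finite intersection_of (\<lambda>x. x \<in> B) relative_to \<Union>B) U"
        "\<Union>\<U> = S"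
      unfolding union_of_def by auto
    have "generate_topology_on B U" if U: "U \<in> \<U>" for U
    proof -
      obtain F where F: "finite F" "F \<subseteq> B" "\<Union>B \<inter> \<Inter>F = U"
        using \<U>(1)[OF U] unfolding relative_to_def intersection_of_def by blast
      have "generate_topology_on B (\<Union>B)"
        by (intro generate_topology_on.UN generate_topology_on.Basis)
      then have "generate_topology_on B (\<Inter>(insert (\<Union>B) F))"
        using F by (intro generate_topology_on_Inter) (auto intro: generate_topology_on.Basis)
      then show ?thesis
        using F(3) by simp
    qed
    then show "generate_topology_on B S"
      using \<U>(2) generate_topology_on.UN by blast
  qed
  then have "generate_topology_on B = ?T"
    by (rule ext)
  then show ?thesis
    by (simp only:)
qed

text \<open>A set \<open>S\<close> is a chain iff
  \<open>S \<times> S \<subseteq> r \<union> r\<inverse>\<close>; the right side is closed, and the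
  closure of a square is the square of the closure.\<close>

lemma CC_closure_of_chain:
  assumes P: "priestley_space X r" and S: "S \<in> Chains r" "S \<noteq> {}" "S \<subseteq> topspace X"
  shows "X closure_of S \<in> CC X r"
proof -
  have "closedin (prod_topology X X) (r\<inverse>)"
  proof -
    have "closedin (prod_topology X X) {z \<in> topspace (prod_topology X X). (snd z, fst z) \<in> r}"
      by (rule closedin_continuous_map_preimage[OF _ priestley_space_closedin_order[OF P]])
        (simp add: continuous_map_paired continuous_map_fst continuous_map_snd)
    also have "{z \<in> topspace (prod_topology X X). (snd z, fst z) \<in> r} = r\<inverse>"
      using priestley_spaceD(2)[OF P] by auto
    finally show ?thesis .
  qed
  then have "closedin (prod_topology X X) (r \<union> r\<inverse>)"
    using priestley_space_closedin_order[OF P] by (rule closedin_Un[rotated])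
  moreover have "S \<times> S \<subseteq> r \<union> r\<inverse>"
    using S by (auto simp: Chains_def)
  ultimately have "(prod_topology X X) closure_of (S \<times> S) \<subseteq> r \<union> r\<inverse>"
    by (simp add: closure_of_minimal)
  then have "X closure_of S \<in> Chains r"
    by (auto simp: closure_of_Times Chains_def)
  moreover have "X closure_of S \<noteq> {}"
    using S by (simp add: closure_of_eq_empty)
  ultimately show ?thesis
    by (simp add: CC_def)
qed

text \<open>Consider functions picking a point outside each box set \<open>V\<close> of the cover,
  with pairwise comparable values that avoid all diamond sets \<open>W\<close>. The closure of the
  range of such a function lies in no member of the cover. The constraints are closed in a power of
  \<open>X\<close>, so by compactness it suffices to satisfy finitely many at a time.\<close>

lemma compact_space_CC_topology:
  assumes P: "priestley_space X r"
  shows "compact_space (CC_topology X r)"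
proof (rule Alexander_subbase)
  let ?B = "{CC_box X r V |V. clopenin X V} \<union> {CC_diamond X r V |V. clopenin X V}"
  show "topology (arbitrary union_of (finite intersection_of (\<lambda>x. x \<in> ?B) relative_to \<Union>?B)) = CC_topology X r"
    by (simp only: CC_topology_def topology_generated_by_eq_subbase)
  fix \<C>
  assume \<C>: "\<C> \<subseteq> ?B" "\<Union>\<C> = topspace (CC_topology X r)"
  show "\<exists>\<C>'. finite \<C>' \<and> \<C>' \<subseteq> \<C> \<and> \<Union>\<C>' = topspace (CC_topology X r)"
  proof (rule ccontr)
    assume nofin: "\<not> ?thesis"
    \<comment> \<open>The empty set is added so that the index set of the product is nonempty.\<close>
    define I where "I = insert {} {V. clopenin X V \<and> CC_box X r V \<in> \<C>}"
    define \<W> where "\<W> = {W. clopenin X W \<and> CC_diamond X r W \<in> \<C>}"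
    define Y where "Y = product_topology (\<lambda>_. X) I"
    \<comment> \<open>The functions meeting all constraints with indices in \<open>J\<close> and
      \<open>K\<close>. Inserting \<open>topspace Y\<close> gives the intended value when
      \<open>J\<close> is empty, where the bare intersection would be \<open>UNIV\<close>.\<close>
    define Z where "Z = (\<lambda>(J, K). \<Inter>(insert (topspace Y)
       ((\<lambda>V. {f \<in> topspace Y. f V \<in> topspace X - V}) ` J \<union>
        (\<lambda>(V, W). {f \<in> topspace Y. f V \<in> topspace X - W}) ` (J \<times> K) \<union>
        (\<lambda>(V, V'). {f \<in> topspace Y. (f V, f V') \<in> r} \<union> {f \<in> topspace Y. (f V', f V) \<in> r}) ` (J \<times> J))))"
    define \<I> where "\<I> = {(J, K). finite J \<and> J \<subseteq> I \<and> finite K \<and> K \<subseteq> \<W>}"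
    have Z_iff: "f \<in> Z (J, K) \<longleftrightarrow> f \<in> topspace Y \<and> (\<forall>V\<in>J. f V \<in> topspace X - V) \<and>
        (\<forall>V\<in>J. \<forall>W\<in>K. f V \<in> topspace X - W) \<and>
        (\<forall>V\<in>J. \<forall>V'\<in>J. (f V, f V') \<in> r \<or> (f V', f V) \<in> r)" for f J K
      unfolding Z_def by (simp add: ball_Un) blast
    have Z_closed: "closedin Y (Z p)" if p\<I>: "p \<in> \<I>" for p
    proof -
      obtain J K where p: "p = (J, K)" "J \<subseteq> I" "K \<subseteq> \<W>"
        using p\<I> by (auto simp: \<I>_def)
      have proj: "continuous_map Y X (\<lambda>f. f V)" if "V \<in> J" for V
        using that p continuous_map_product_projection[of V I "\<lambda>_. X"] by (auto simp: Y_def)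
      have 1: "closedin Y {f \<in> topspace Y. f V \<in> topspace X - W}" if "V \<in> J" "clopenin X W" for V W
        using closedin_continuous_map_preimage[OF proj[OF that(1)]] clopenin_Compl[OF that(2)]
        unfolding clopenin_def by blast
      have 2: "closedin Y {f \<in> topspace Y. (f V, f V') \<in> r}" if "V \<in> J" "V' \<in> J" for V V'
        using proj[OF that(1)] proj[OF that(2)]
        by (intro closedin_continuous_map_preimage[OF _ priestley_space_closedin_order[OF P]])
          (simp add: continuous_map_paired)
      have I: "clopenin X V" if "V \<in> I" for V
        using that by (auto simp: I_def clopenin_empty)
      have W: "clopenin X W" if "W \<in> \<W>" for W
        using that by (auto simp: \<W>_def)
      show ?thesis
        unfolding p(1) Z_def prod.case
      proof (rule closedin_Inter)
        fix S
        assume "S \<in> insert (topspace Y)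
         ((\<lambda>V. {f \<in> topspace Y. f V \<in> topspace X - V}) ` J \<union>
          (\<lambda>(V, W). {f \<in> topspace Y. f V \<in> topspace X - W}) ` (J \<times> K) \<union>
          (\<lambda>(V, V'). {f \<in> topspace Y. (f V, f V') \<in> r} \<union> {f \<in> topspace Y. (f V', f V) \<in> r}) ` (J \<times> J))"
        then consider "S = topspace Y"
          | V where "V \<in> J" "S = {f \<in> topspace Y. f V \<in> topspace X - V}"
          | V W where "V \<in> J" "W \<in> K" "S = {f \<in> topspace Y. f V \<in> topspace X - W}"
          | V V' where "V \<in> J" "V' \<in> J"
              "S = {f \<in> topspace Y. (f V, f V') \<in> r} \<union> {f \<in> topspace Y. (f V', f V) \<in> r}"
          by (elim insertE UnE imageE SigmaE) simp_all
        then show "closedin Y S"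
          using p(2,3) 1 2 I W by cases (auto simp del: Diff_iff intro: closedin_Un)
      qed blast
    qed
    have Z_nonempty: "Z p \<noteq> {}" if p\<I>: "p \<in> \<I>" for p
    proof -
      obtain J K where p: "p = (J, K)" "finite J" "finite K" "J \<subseteq> I" "K \<subseteq> \<W>"
        using p\<I> by (auto simp: \<I>_def)
      \<comment> \<open>The artificial index \<open>{}\<close> is dropped because its box need not
        belong to the cover.\<close>
      let ?\<C> = "CC_box X r ` (J - {{}}) \<union> CC_diamond X r ` K"
      have "finite ?\<C>" "?\<C> \<subseteq> \<C>"
        using p by (auto simp: I_def \<W>_def)
      then have "\<Union>?\<C> \<noteq> CC X r"
        using nofin by (metis topspace_CC_topology)
      moreover have "\<Union>?\<C> \<subseteq> CC X r"
        by (auto simp: CC_box_def CC_diamond_def)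
      ultimately obtain C where C: "C \<in> CC X r" "C \<notin> \<Union>?\<C>"
        by blast
      have C': "C \<noteq> {}" "C \<subseteq> topspace X" "C \<in> Chains r"
        using C(1) by (auto simp: CC_def dest: closedin_subset)
      \<comment> \<open>One uncovered chain \<open>C\<close> supplies the values at all indices,
        which makes them pairwise comparable and keeps them outside every set in
        \<open>K\<close>.\<close>
      have "\<exists>x. x \<in> C \<and> (V \<in> J \<longrightarrow> x \<notin> V)" for V
      proof (cases "V \<in> J - {{}}")
        case True
        then have "\<not> C \<subseteq> V"
          using C by (auto simp: CC_box_def)
        then show ?thesis
          by blast
      qed (use C' in blast)
      then have "\<exists>g. \<forall>V. g V \<in> C \<and> (V \<in> J \<longrightarrow> g V \<notin> V)"
        by (intro choice allI)
      then obtain g where g: "\<And>V. g V \<in> C \<and> (V \<in> J \<longrightarrow> g V \<notin> V)"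
        by blast
      have avoid: "g V \<notin> W" if "W \<in> K" for V W
        using C that g by (auto simp: CC_diamond_def)
      have "restrict g I \<in> topspace Y"
        using g C' by (auto simp: Y_def topspace_product_topology)
      moreover have "restrict g I V \<in> C \<and> restrict g I V \<notin> V" if "V \<in> J" for V
        using that p g by auto
      moreover have "restrict g I V \<notin> W" if "V \<in> J" "W \<in> K" for V W
        using that p avoid by auto
      ultimately have "restrict g I \<in> Z (J, K)"
        unfolding Z_iff using C'(2,3) by (simp add: Chains_def subset_iff)
      then have "restrict g I \<in> Z p"
        by (simp only: p(1))
      then show ?thesis
        by blast
    qed
    have "compact_space Y"
      by (simp add: Y_def compact_space_product_topology priestley_spaceD(1)[OF P])
    have "\<Inter>(Z ` \<I>) \<noteq> {}"
    proof (rule compact_space_fip[THEN iffD1, rule_format, OF \<open>compact_space Y\<close>], intro conjI ballI allI impI)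
      fix F assume "finite F \<and> F \<subseteq> Z ` \<I>"
      then obtain S where S: "finite S" "S \<subseteq> \<I>" "F = Z ` S"
        by (meson finite_subset_image)
      \<comment> \<open>The constraints for the united index sets imply those for each member of
        \<open>S\<close>, so a single nonempty \<open>Z (J, K)\<close> settles the finite
        intersection property.\<close>
      define J K where "J = \<Union>(fst ` S)" and "K = \<Union>(snd ` S)"
      have "finite (fst p) \<and> fst p \<subseteq> I \<and> finite (snd p) \<and> snd p \<subseteq> \<W>" if "p \<in> S" for p
        using subsetD[OF S(2) that] by (auto simp: \<I>_def)
      then have "(J, K) \<in> \<I>"
        using S(1) by (auto simp: J_def K_def \<I>_def)
      then obtain f where f: "f \<in> Z (J, K)"
        using Z_nonempty by blast
      have "f \<in> Z p" if "p \<in> S" for p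
      proof (cases p)
        case (Pair J' K')
        then have "J' \<subseteq> J" "K' \<subseteq> K"
          using that by (force simp: J_def K_def)+
        then show ?thesis
          using f unfolding Pair Z_iff by (meson subsetD)
      qed
      then show "\<Inter>F \<noteq> {}"
        using S(3) by blast
    qed (use Z_closed in blast)
    then obtain f where f: "\<And>p. p \<in> \<I> \<Longrightarrow> f \<in> Z p"
      by blast
    have f_box: "f V \<in> topspace X - V" if "V \<in> I" for V
      using f[of "({V}, {})"] that by (simp add: \<I>_def Z_iff)
    have f_diamond: "f V \<notin> W" if "V \<in> I" "W \<in> \<W>" for V W
      using f[of "({V}, {W})"] that by (simp add: \<I>_def Z_iff)
    have f_chain: "(f V, f V') \<in> r \<or> (f V', f V) \<in> r" if "V \<in> I" "V' \<in> I" for V V'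
      using f[of "({V, V'}, {})"] that by (simp add: \<I>_def Z_iff)
    let ?C = "X closure_of (f ` I)"
    have sub: "f ` I \<subseteq> ?C"
      using f_box by (intro closure_of_subset) auto
    have "?C \<in> CC X r"
      using f_box f_chain by (intro CC_closure_of_chain[OF P]) (auto simp: Chains_def I_def)
    then obtain c where c: "c \<in> \<C>" "?C \<in> c"
      using \<C>(2) by (auto simp: topspace_CC_topology)
    then consider V where "clopenin X V" "c = CC_box X r V" | W where "clopenin X W" "c = CC_diamond X r W"
      using \<C>(1) by blast
    then show False
    proof cases
      case 1
      then have "V \<in> I" "?C \<subseteq> V"
        using c by (auto simp: I_def CC_box_def)
      then show False
        using sub f_box by blast
    next
      case 2
      then have "W \<in> \<W>" "?C \<inter> W \<noteq> {}"
        using c by (auto simp: \<W>_def CC_diamond_def)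
      then have "f ` I \<inter> W \<noteq> {}"
        using 2(1) openin_Int_closure_of_eq_empty[of X W "f ` I"] by (auto simp: clopenin_def)
      then show False
        using f_diamond \<open>W \<in> \<W>\<close> by blast
    qed
  qed
qed


section \<open>Basic open sets of closed chains\<close>

lemma CC_nonempty: "C \<in> CC X r \<Longrightarrow> C \<noteq> {}"
  by (simp add: CC_def)

lemma CC_closedin: "C \<in> CC X r \<Longrightarrow> closedin X C"
  by (simp add: CC_def)

lemma CC_subset: "C \<in> CC X r \<Longrightarrow> C \<subseteq> topspace X"
  by (simp add: CC_def closedin_subset)

lemma CC_comparable: "C \<in> CC X r \<Longrightarrow> x \<in> C \<Longrightarrow> y \<in> C \<Longrightarrow> (x, y) \<in> r \<or> (y, x) \<in> r"
  by (simp add: CC_def Chains_def)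

text \<open>Complementation exchanges boxes and diamonds, so each subbasic open set is also
  closed.\<close>

lemma clopenin_CC_box_diamond:
  assumes "clopenin X V"
  shows "clopenin (CC_topology X r) (CC_box X r V)"
    and "clopenin (CC_topology X r) (CC_diamond X r V)"
proof -
  have op: "openin (CC_topology X r) (CC_box X r V)" "openin (CC_topology X r) (CC_diamond X r V)"
    if "clopenin X V" for V
    using that unfolding CC_topology_def by (blast intro: topology_generated_by_Basis)+
  have "CC X r - CC_box X r V = CC_diamond X r (topspace X - V)"
    "CC X r - CC_diamond X r V = CC_box X r (topspace X - V)"
    using CC_subset by (fastforce simp: CC_box_def CC_diamond_def)+
  moreover have "CC_box X r V \<subseteq> CC X r" "CC_diamond X r V \<subseteq> CC X r"
    by (auto simp: CC_box_def CC_diamond_def)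
  ultimately show "clopenin (CC_topology X r) (CC_box X r V)"
    "clopenin (CC_topology X r) (CC_diamond X r V)"
    using op[OF assms] op[OF clopenin_Compl[OF assms]]
    by (simp_all add: clopenin_def closedin_def topspace_CC_topology)
qed

text \<open>Normal form of a finite intersection of subbasic sets: one box suffices because the
  boxes of \<open>V\<close> and \<open>V'\<close> intersect in the box of
  \<open>V \<inter> V'\<close>.\<close>

definition CC_basic :: "'a topology \<Rightarrow> 'a rel \<Rightarrow> 'a set \<Rightarrow> 'a set set \<Rightarrow> 'a set set"
  where "CC_basic X r V F = {C \<in> CC X r. C \<subseteq> V \<and> (\<forall>W\<in>F. C \<inter> W \<noteq> {})}"

lemma openin_CC_basic:
  assumes "clopenin X V" "finite F" "\<And>W. W \<in> F \<Longrightarrow> clopenin X W"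
  shows "openin (CC_topology X r) (CC_basic X r V F)"
proof -
  have "openin (CC_topology X r) (\<Inter>(insert (CC_box X r V) (CC_diamond X r ` F)))"
    using assms clopenin_CC_box_diamond[of X _ r] by (intro openin_Inter) (auto simp: clopenin_def)
  moreover have "\<Inter>(insert (CC_box X r V) (CC_diamond X r ` F)) = CC_basic X r V F"
    by (auto simp: CC_box_def CC_diamond_def CC_basic_def)
  ultimately show ?thesis
    by simp
qed

text \<open>Induction over the generation of the topology; intersecting two basic sets intersects
  the box sets and unites the families of diamond sets.\<close>

lemma openin_CC_topology_basic:
  assumes "openin (CC_topology X r) O'" "C \<in> O'"
  obtains V F where "clopenin X V" "finite F" "\<And>W. W \<in> F \<Longrightarrow> clopenin X W"
    "C \<in> CC_basic X r V F" "CC_basic X r V F \<subseteq> O'"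
proof -
  let ?P = "\<lambda>O'. \<forall>C\<in>O'. \<exists>V F. clopenin X V \<and> finite F \<and> (\<forall>W\<in>F. clopenin X W) \<and>
    C \<in> CC_basic X r V F \<and> CC_basic X r V F \<subseteq> O'"
  have "generate_topology_on
      ({CC_box X r V |V. clopenin X V} \<union> {CC_diamond X r V |V. clopenin X V}) O'"
    using assms(1) unfolding CC_topology_def by (rule openin_topology_generated_by)
  then have "?P O'"
  proof (induction rule: generate_topology_on.induct)
    case (Int a b)
    show ?case
    proof
      fix C assume "C \<in> a \<inter> b"
      then have C: "C \<in> a" "C \<in> b"
        by auto
      obtain V F where 1: "clopenin X V" "finite F" "\<forall>W\<in>F. clopenin X W"
          "C \<in> CC_basic X r V F" "CC_basic X r V F \<subseteq> a"
        using bspec[OF Int.IH(1) C(1)] by metis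
      obtain V' F' where 2: "clopenin X V'" "finite F'" "\<forall>W\<in>F'. clopenin X W"
          "C \<in> CC_basic X r V' F'" "CC_basic X r V' F' \<subseteq> b"
        using bspec[OF Int.IH(2) C(2)] by metis
      have "CC_basic X r (V \<inter> V') (F \<union> F') = CC_basic X r V F \<inter> CC_basic X r V' F'"
        by (auto simp: CC_basic_def)
      then show "\<exists>V F. clopenin X V \<and> finite F \<and> (\<forall>W\<in>F. clopenin X W) \<and>
          C \<in> CC_basic X r V F \<and> CC_basic X r V F \<subseteq> a \<inter> b"
        using 1 2 by (intro exI[of _ "V \<inter> V'"] exI[of _ "F \<union> F'"]) (auto simp: clopenin_Int)
    qed
  next
    case (UN K)
    show ?case
    proof
      fix C assume "C \<in> \<Union>K"
      then obtain k where k: "k \<in> K" "C \<in> k"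
        by blast
      then obtain V F where "clopenin X V" "finite F" "\<forall>W\<in>F. clopenin X W" "C \<in> CC_basic X r V F"
        "CC_basic X r V F \<subseteq> k"
        using bspec[OF UN.IH[OF k(1)] k(2)] by metis
      then show "\<exists>V F. clopenin X V \<and> finite F \<and> (\<forall>W\<in>F. clopenin X W) \<and>
          C \<in> CC_basic X r V F \<and> CC_basic X r V F \<subseteq> \<Union>K"
        using k(1) by (intro exI[of _ V] exI[of _ F]) auto
    qed
  next
    case (Basis s)
    then consider V where "clopenin X V" "s = CC_box X r V" | V where "clopenin X V" "s = CC_diamond X r V"
      by blast
    then show ?case
    proof cases
      case 1
      then have "s = CC_basic X r V {}"
        by (auto simp: CC_box_def CC_basic_def)
      then show ?thesis
        using 1 by (intro ballI exI[of _ V] exI[of _ "{}"]) auto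
    next
      case 2
      then have "s = CC_basic X r (topspace X) {V}"
        using CC_subset by (auto simp: CC_diamond_def CC_basic_def)
      then show ?thesis
        using 2 clopenin_topspace by (intro ballI exI[of _ "topspace X"] exI[of _ "{V}"]) auto
    qed
  qed simp
  from bspec[OF this assms(2)] show thesis
    using that by metis
qed

section \<open>The Priestley order on closed chains\<close>

lemma CC_orderI:
  "C \<in> CC X r \<Longrightarrow> D \<in> CC X r \<Longrightarrow> D \<subseteq> C \<Longrightarrow>
    (\<And>x y. x \<in> D \<Longrightarrow> y \<in> C \<Longrightarrow> (x, y) \<in> r \<Longrightarrow> y \<in> D) \<Longrightarrow> (C, D) \<in> CC_order X r"
  by (auto simp: CC_order_def upset_of_def)

lemma CC_orderD:
  assumes "(C, D) \<in> CC_order X r"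
  shows "C \<in> CC X r" "D \<in> CC X r" "D \<subseteq> C"
    and "x \<in> D \<Longrightarrow> y \<in> C \<Longrightarrow> (x, y) \<in> r \<Longrightarrow> y \<in> D"
  using assms by (auto simp: CC_order_def upset_of_def)

lemma partial_order_on_CC_order: "partial_order_on (CC X r) (CC_order X r)"
  unfolding partial_order_on_def preorder_on_def
proof (intro conjI)
  show "CC_order X r \<subseteq> CC X r \<times> CC X r"
    by (auto simp: CC_order_def)
  show "refl_on (CC X r) (CC_order X r)"
    by (auto simp: refl_on_def intro: CC_orderI)
  show "antisym (CC_order X r)"
    by (intro antisymI equalityI) (auto dest: CC_orderD(3))
  show "trans (CC_order X r)"
  proof (rule transI)
    fix C D E assume CD: "(C, D) \<in> CC_order X r" and DE: "(D, E) \<in> CC_order X r"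
    show "(C, E) \<in> CC_order X r"
    proof (rule CC_orderI)
      fix x y assume "x \<in> E" "y \<in> C" "(x, y) \<in> r"
      then show "y \<in> E"
        using CC_orderD(3,4)[OF CD] CC_orderD(3,4)[OF DE] by blast
    qed (use CC_orderD(1-3)[OF CD] CC_orderD(1-3)[OF DE] in auto)
  qed
qed

lemma upset_of_CC_box: "upset_of (CC_order X r) (CC X r) (CC_box X r V)"
  unfolding upset_of_def CC_box_def by (blast dest: CC_orderD(3))

text \<open>
  An element of \<open>V\<close> in the larger chain cannot lie below an element of the smaller chain outside
  the upset \<open>U\<close>, so it already belongs to the smaller chain.
\<close>

lemma upset_of_CC_box_Un_diamond:
  assumes "upset_of r (topspace X) U" "V \<subseteq> U"
  shows "upset_of (CC_order X r) (CC X r) (CC_box X r U \<union> CC_diamond X r V)"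
  unfolding upset_of_def
proof (intro conjI ballI impI)
  show "CC_box X r U \<union> CC_diamond X r V \<subseteq> CC X r"
    by (auto simp: CC_box_def CC_diamond_def)
next
  fix C D assume C: "C \<in> CC_box X r U \<union> CC_diamond X r V" and D: "D \<in> CC X r"
    and CD: "(C, D) \<in> CC_order X r"
  note le = CC_orderD[OF CD]
  show "D \<in> CC_box X r U \<union> CC_diamond X r V"
  proof (cases "D \<subseteq> U")
    case False
    then obtain d where d: "d \<in> D" "d \<notin> U"
      by blast
    then have "C \<notin> CC_box X r U"
      using le(3) by (auto simp: CC_box_def)
    then obtain v where v: "v \<in> C" "v \<in> V"
      using C by (auto simp: CC_diamond_def)
    have "(v, d) \<notin> r"
      using assms v d CC_subset[OF D] unfolding upset_of_def by blast
    then have "(d, v) \<in> r"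
      using CC_comparable[OF le(1), of d v] d(1) v(1) le(3) by blast
    then have "v \<in> D"
      using le(4) d(1) v(1) by blast
    then show ?thesis
      using D v(2) by (auto simp: CC_diamond_def)
  qed (use D in \<open>simp add: CC_box_def\<close>)
qed

text \<open>The order can fail in two ways: if \<open>D\<close> is not contained in
  \<open>C\<close>, a box around \<open>C\<close> separates; if \<open>D\<close> is contained in
  \<open>C\<close> without being an upset of it, a box joined with a diamond does.\<close>

lemma priestley_space_CC:
  assumes P: "priestley_space X r"
  shows "priestley_space (CC_topology X r) (CC_order X r)"
  unfolding priestley_space_def topspace_CC_topology
proof (intro conjI ballI impI compact_space_CC_topology[OF P] partial_order_on_CC_order)
  fix C D assume C: "C \<in> CC X r" and D: "D \<in> CC X r" and CD: "(C, D) \<notin> CC_order X r"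
  let ?sep = "\<exists>U. clopenin (CC_topology X r) U \<and> upset_of (CC_order X r) (CC X r) U \<and> C \<in> U \<and> D \<notin> U"
  show ?sep
  proof (cases "D \<subseteq> C")
    case False
    then obtain x where x: "x \<in> D" "x \<notin> C"
      by blast
    then obtain N where "clopenin X N" "C \<subseteq> N" "x \<notin> N"
      using priestley_space_clopen_superset[OF P CC_closedin[OF C], of x] CC_subset[OF D] by blast
    then show ?thesis
      using C x upset_of_CC_box[of X r N] clopenin_CC_box_diamond(1)[of X N r]
      by (intro exI[of _ "CC_box X r N"]) (auto simp: CC_box_def)
  next
    case True
    then obtain x y where xy: "x \<in> D" "y \<in> C" "(x, y) \<in> r" "y \<notin> D"
      using CC_orderI[OF C D] CD by blast
    have top: "x \<in> topspace X" "y \<in> topspace X"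
      using xy CC_subset[OF C] CC_subset[OF D] by blast+
    \<comment> \<open>Although \<open>x\<close> lies below \<open>y\<close>, antisymmetry yields a
      clopen upset around \<open>y\<close> that misses \<open>x\<close>.\<close>
    have "(y, x) \<notin> r"
      using priestley_spaceD(5)[OF P, of x y] xy by blast
    then obtain U where U: "clopenin X U" "upset_of r (topspace X) U" "y \<in> U" "x \<notin> U"
      using priestley_space_separation[OF P top(2,1)] by blast
    obtain N where N: "clopenin X N" "D \<subseteq> N" "y \<notin> N"
      using priestley_space_clopen_superset[OF P CC_closedin[OF D] top(2)] xy by blast
    \<comment> \<open>The point \<open>y\<close> puts \<open>C\<close> into the diamond of
      \<open>U - N\<close>; \<open>D\<close> avoids this diamond because it lies in
      \<open>N\<close>, and the box because \<open>x\<close> is outside \<open>U\<close>.\<close>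
    let ?E = "CC_box X r U \<union> CC_diamond X r (U - N)"
    have "clopenin (CC_topology X r) ?E"
      using U(1) N(1) by (intro clopenin_Un clopenin_CC_box_diamond clopenin_Diff)
    moreover have "upset_of (CC_order X r) (CC X r) ?E"
      using U(2) by (rule upset_of_CC_box_Un_diamond) blast
    moreover have "C \<in> ?E"
      using C xy(2) U(3) N(3) by (auto simp: CC_diamond_def)
    moreover have "D \<notin> ?E"
      using xy(1) U(4) N(2) by (auto simp: CC_box_def CC_diamond_def)
    ultimately show ?thesis
      by blast
  qed
qed

section \<open>Downsets and upsets of open sets of closed chains\<close>

text \<open>Cutting a chain \<open>C'\<close> by a clopen upset \<open>U\<close> that it meets gives
  an element above \<open>C'\<close> in the order, so it suffices to find \<open>U\<close> for which
  the cut lands in \<open>O'\<close> for all \<open>C'\<close> near \<open>C\<close>.\<close>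

lemma openin_CC_downset:
  assumes P: "priestley_space X r" and O': "openin (CC_topology X r) O'"
  shows "openin (CC_topology X r) ((CC_order X r)\<inverse> `` O')"
proof -
  have "\<exists>T. openin (CC_topology X r) T \<and> C \<in> T \<and> T \<subseteq> (CC_order X r)\<inverse> `` O'"
    if C_down: "C \<in> (CC_order X r)\<inverse> `` O'" for C
  proof -
    obtain D where D: "D \<in> O'" and CD: "(C, D) \<in> CC_order X r"
      using C_down by blast
    note le = CC_orderD[OF CD]
    obtain V F where VF: "clopenin X V" "finite F" "\<And>W. W \<in> F \<Longrightarrow> clopenin X W"
      "D \<in> CC_basic X r V F" "CC_basic X r V F \<subseteq> O'"
      using openin_CC_topology_basic[OF O' D] by metis
    \<comment> \<open>\<open>V\<close> is added to the sets to be met so that the later cuts are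
      nonempty even if \<open>F\<close> is empty.\<close>
    define G where "G = insert V F"
    have G: "finite G" "\<And>W. W \<in> G \<Longrightarrow> clopenin X W" "\<And>W. W \<in> G \<Longrightarrow> D \<inter> W \<noteq> {}" "D \<subseteq> V"
      using VF CC_nonempty[OF le(2)] by (auto simp: G_def CC_basic_def)
    have "\<exists>U. clopenin X U \<and> upset_of r (topspace X) U \<and> U \<inter> C \<inter> W \<noteq> {} \<and> U \<inter> (C - V) = {}"
      if W: "W \<in> G" for W
    proof -
      obtain w where w: "w \<in> D" "w \<in> W"
        using G(3)[OF W] by blast
      have K: "closedin X (C - V)"
        using CC_closedin[OF le(1)] VF(1) by (simp add: clopenin_def closedin_diff)
      \<comment> \<open>A point of \<open>C\<close> above \<open>w\<close> would belong to the upset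
        \<open>D\<close> of \<open>C\<close>, hence to \<open>V\<close>.\<close>
      have "(w, k) \<notin> r" if "k \<in> C - V" for k
        using le(4)[OF w(1), of k] that G(4) by blast
      then obtain U where "clopenin X U" "upset_of r (topspace X) U" "w \<in> U" "U \<inter> (C - V) = {}"
        using priestley_space_upset_avoiding_closed[OF P K, of w] w CC_subset[OF le(2)] by blast
      then show ?thesis
        using w le(3) by blast
    qed
    then obtain u where u: "\<And>W. W \<in> G \<Longrightarrow> clopenin X (u W)"
      "\<And>W. W \<in> G \<Longrightarrow> upset_of r (topspace X) (u W)"
      "\<And>W. W \<in> G \<Longrightarrow> u W \<inter> C \<inter> W \<noteq> {}" "\<And>W. W \<in> G \<Longrightarrow> u W \<inter> (C - V) = {}"
      by metis
    define U where "U = \<Union>(u ` G)"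
    have U: "clopenin X U" "upset_of r (topspace X) U"
      unfolding U_def using G(1) u(1,2) by (auto intro!: clopenin_Union upset_of_Union)
    \<comment> \<open>The inclusion \<open>C' \<inter> U \<subseteq> V\<close> becomes a box
      condition on \<open>C'\<close>, and the sets to be met by the cut become diamonds of
      \<open>W \<inter> U\<close>.\<close>
    define T where "T = CC_basic X r (V \<union> (topspace X - U)) ((\<lambda>W. W \<inter> U) ` G)"
    have "openin (CC_topology X r) T"
      unfolding T_def using VF(1) U(1) G(1,2)
      by (intro openin_CC_basic clopenin_Un clopenin_Compl) (auto intro: clopenin_Int)
    moreover have "C \<in> T"
    proof -
      have "C \<subseteq> V \<union> (topspace X - U)"
        using u(4) CC_subset[OF le(1)] unfolding U_def by blast
      moreover have "C \<inter> (W \<inter> U) \<noteq> {}" if "W \<in> G" for W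
        using u(3)[OF that] that unfolding U_def by blast
      ultimately show ?thesis
        unfolding T_def CC_basic_def using le(1) by blast
    qed
    moreover have "T \<subseteq> (CC_order X r)\<inverse> `` O'"
    proof
      fix C' assume "C' \<in> T"
      then have C': "C' \<in> CC X r" "C' \<subseteq> V \<union> (topspace X - U)" "\<And>W. W \<in> G \<Longrightarrow> C' \<inter> (W \<inter> U) \<noteq> {}"
        by (auto simp: T_def CC_basic_def)
      have "C' \<inter> U \<noteq> {}"
        using C'(3)[of V] by (auto simp: G_def)
      then have CU: "C' \<inter> U \<in> CC X r"
        using C'(1) U(1) by (auto simp: CC_def Chains_def clopenin_def closedin_Int)
      then have "C' \<inter> U \<in> CC_basic X r V F"
        using C'(2,3) unfolding CC_basic_def G_def by blast
      moreover have "(C', C' \<inter> U) \<in> CC_order X r"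
        using U(2) CC_subset[OF C'(1)] unfolding upset_of_def
        by (intro CC_orderI[OF C'(1) CU]) blast+
      ultimately show "C' \<in> (CC_order X r)\<inverse> `` O'"
        using VF(5) by blast
    qed
    ultimately show ?thesis
      by blast
  qed
  then show ?thesis
    by (subst openin_subopen) blast
qed

section \<open>Openness of upsets over a co-Esakia space\<close>

text \<open>Following the given witnesses upwards, \<open>T\<close> is built by alternately
  intersecting with a \<open>W i\<close> and taking the generated upset; the co-Esakia property
  keeps it clopen. The induction strips off the greatest witness.\<close>

lemma co_esakia_space_finite_chain:
  assumes coE: "co_esakia_space X r" and "finite I"
    and "\<And>i. i \<in> I \<Longrightarrow> clopenin X (W i)" "\<And>i. i \<in> I \<Longrightarrow> w i \<in> W i" "w ` I \<in> Chains r"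
  shows "\<exists>T. clopenin X T \<and> (\<forall>x\<in>topspace X. (\<forall>i\<in>I. (w i, x) \<in> r) \<longrightarrow> x \<in> T) \<and>
    (\<forall>t\<in>T. \<exists>w'. (\<forall>i\<in>I. w' i \<in> W i \<and> (w' i, t) \<in> r) \<and> w' ` I \<in> Chains r)"
  using assms(2-)
proof (induction "card I" arbitrary: I)
  case 0
  then show ?case
    by (intro exI[of _ "topspace X"]) (auto simp: clopenin_topspace Chains_def)
next
  case (Suc n)
  have P: "priestley_space X r"
    using coE by (simp add: co_esakia_space_def)
  have "w ` I \<noteq> {}"
    using Suc.hyps(2) by auto
  then obtain j where j: "j \<in> I" "\<And>i. i \<in> I \<Longrightarrow> (w i, w j) \<in> r"
    using finite_chain_has_greatest[of "w ` I" r] Suc.prems(1,4) priestley_spaceD(4)[OF P]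
    by (metis finite_imageI imageE imageI transI)
  let ?I = "I - {j}"
  have "n = card ?I"
    using Suc.hyps(2) j(1) Suc.prems(1) by simp
  moreover have "w ` ?I \<in> Chains r"
    using Suc.prems(4) by (auto simp: Chains_def)
  ultimately obtain T where T: "clopenin X T"
    "\<And>x. x \<in> topspace X \<Longrightarrow> (\<And>i. i \<in> ?I \<Longrightarrow> (w i, x) \<in> r) \<Longrightarrow> x \<in> T"
    "\<And>t. t \<in> T \<Longrightarrow> \<exists>w'. (\<forall>i\<in>?I. w' i \<in> W i \<and> (w' i, t) \<in> r) \<and> w' ` ?I \<in> Chains r"
    using Suc.hyps(1)[of ?I] Suc.prems(1-3) by auto
  \<comment> \<open>A point of \<open>T \<inter> W j\<close> plays the role of the greatest witness,
    with new choices for the remaining ones below it.\<close>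
  let ?T = "r `` (T \<inter> W j)"
  have Wj: "clopenin X (W j)" "w j \<in> W j"
    using Suc.prems(2,3) j(1) by blast+
  have "clopenin X ?T"
    using coE clopenin_Int[OF T(1) Wj(1)] by (simp add: co_esakia_space_def)
  moreover have "x \<in> ?T" if "x \<in> topspace X" "\<forall>i\<in>I. (w i, x) \<in> r" for x
  proof -
    \<comment> \<open>The greatest witness lies above all others, so the smaller instance captures
      it.\<close>
    have "w j \<in> T"
      using T(2)[of "w j"] j Wj clopenin_subset[OF Wj(1)] by blast
    then show ?thesis
      using that j(1) Wj(2) by blast
  qed
  moreover have "\<exists>w'. (\<forall>i\<in>I. w' i \<in> W i \<and> (w' i, t) \<in> r) \<and> w' ` I \<in> Chains r" if t: "t \<in> ?T" for t
  proof -
    obtain s where s: "s \<in> T" "s \<in> W j" "(s, t) \<in> r"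
      using t by blast
    then obtain w' where w': "\<And>i. i \<in> ?I \<Longrightarrow> w' i \<in> W i \<and> (w' i, s) \<in> r" "w' ` ?I \<in> Chains r"
      using T(3) by blast
    have "(s, s) \<in> r"
      using priestley_spaceD(3)[OF P] s(1) clopenin_subset[OF T(1)] by blast
    moreover have "I = insert j ?I"
      using j(1) by blast
    \<comment> \<open>Index \<open>j\<close> receives \<open>s\<close>, which lies above the other
      new witnesses and so extends their chain.\<close>
    then have "(w'(j := s)) ` I = insert s (w' ` ?I)"
      by (metis fun_upd_image image_insert fun_upd_same insert_Diff_single insert_iff)
    ultimately have "(w'(j := s)) ` I \<in> Chains r"
      using w' by (auto simp: Chains_def)
    moreover have "\<forall>i\<in>I. (w'(j := s)) i \<in> W i \<and> ((w'(j := s)) i, t) \<in> r"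
      using w'(1) s priestley_spaceD(4)[OF P] by auto
    ultimately show ?thesis
      by blast
  qed
  ultimately show ?case
    by blast
qed

text \<open>A chain near \<open>D\<close> is extended downwards by finitely many points meeting the
  sets that \<open>D\<close> misses, which produces a chain in \<open>O'\<close> below it in the
  order.\<close>

lemma openin_CC_upset:
  assumes coE: "co_esakia_space X r" and O': "openin (CC_topology X r) O'"
  shows "openin (CC_topology X r) (CC_order X r `` O')"
proof -
  have P: "priestley_space X r"
    using coE by (simp add: co_esakia_space_def)
  have "\<exists>T. openin (CC_topology X r) T \<and> D \<in> T \<and> T \<subseteq> CC_order X r `` O'"
    if D_up: "D \<in> CC_order X r `` O'" for D
  proof -
    obtain C where C: "C \<in> O'" and CD: "(C, D) \<in> CC_order X r"
      using D_up by blast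
    note le = CC_orderD[OF CD]
    obtain V F where VF: "clopenin X V" "finite F" "\<And>W. W \<in> F \<Longrightarrow> clopenin X W"
      "C \<in> CC_basic X r V F" "CC_basic X r V F \<subseteq> O'"
      using openin_CC_topology_basic[OF O' C] by metis
    have CV: "C \<subseteq> V" and CF: "\<And>W. W \<in> F \<Longrightarrow> C \<inter> W \<noteq> {}"
      using VF(4) by (auto simp: CC_basic_def)
    \<comment> \<open>These sets can only be met by points of \<open>C\<close> outside
      \<open>D\<close>.\<close>
    define G where "G = {W \<in> F. D \<inter> W = {}}"
    have "\<exists>w. \<forall>W. W \<in> F \<longrightarrow> w W \<in> C \<inter> W"
      by (intro choice) (use CF in blast)
    then obtain w where w: "\<And>W. W \<in> F \<Longrightarrow> w W \<in> C \<inter> W"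
      by blast
    have "w ` G \<in> Chains r"
      using w CC_comparable[OF le(1)] by (fastforce simp: Chains_def G_def)
    \<comment> \<open>Working with \<open>W \<inter> V\<close> forces the replacement points into
      \<open>V\<close>, as the box requires.\<close>
    moreover have "finite G" "\<And>W. W \<in> G \<Longrightarrow> clopenin X (W \<inter> V)" "\<And>W. W \<in> G \<Longrightarrow> w W \<in> W \<inter> V"
      using VF(1-3) w CV by (auto simp: G_def clopenin_Int)
    ultimately obtain T where T: "clopenin X T"
      "\<And>x. x \<in> topspace X \<Longrightarrow> (\<And>W. W \<in> G \<Longrightarrow> (w W, x) \<in> r) \<Longrightarrow> x \<in> T"
      "\<And>t. t \<in> T \<Longrightarrow> \<exists>w'. (\<forall>W\<in>G. w' W \<in> W \<inter> V \<and> (w' W, t) \<in> r) \<and> w' ` G \<in> Chains r"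
      using co_esakia_space_finite_chain[OF coE, of G "\<lambda>W. W \<inter> V" w] by auto
    let ?T = "CC_basic X r (V \<inter> T) (F - G)"
    have "openin (CC_topology X r) ?T"
      using VF(1-3) T(1) by (intro openin_CC_basic clopenin_Int) auto
    moreover have "D \<in> ?T"
    proof -
      have "d \<in> T" if d: "d \<in> D" for d
      proof (rule T(2))
        show "d \<in> topspace X"
          using d CC_subset[OF le(2)] by blast
        fix W assume "W \<in> G"
        then have "w W \<in> C" "w W \<notin> D"
          using w[of W] by (auto simp: G_def)
        \<comment> \<open>If \<open>w W\<close> were above \<open>d\<close>, the upset
          \<open>D\<close> of \<open>C\<close> would contain it; comparability leaves the other
          direction.\<close>
        then show "(w W, d) \<in> r"
          using CC_comparable[OF le(1), of "w W" d] le(4)[OF d, of "w W"] le(3) d by blast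
      qed
      then show ?thesis
        using le(2,3) CV by (auto simp: CC_basic_def G_def)
    qed
    moreover have "?T \<subseteq> CC_order X r `` O'"
    proof
      fix D' assume "D' \<in> ?T"
      then have D': "D' \<in> CC X r" "D' \<subseteq> V" "D' \<subseteq> T" "\<And>W. W \<in> F - G \<Longrightarrow> D' \<inter> W \<noteq> {}"
        by (auto simp: CC_basic_def)
      \<comment> \<open>It is enough to put the new witnesses below the least element of
        \<open>D'\<close>.\<close>
      obtain t where t: "t \<in> D'" "\<And>d. d \<in> D' \<Longrightarrow> (t, d) \<in> r"
        using CC_has_least[OF P D'(1)] by blast
      then obtain w' where w': "\<And>W. W \<in> G \<Longrightarrow> w' W \<in> W \<inter> V \<and> (w' W, t) \<in> r" "w' ` G \<in> Chains r"
        using T(3)[of t] D'(3) by blast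
      have below: "(w' W, d) \<in> r" if "W \<in> G" "d \<in> D'" for W d
        using w'(1)[OF that(1)] t(2)[OF that(2)] priestley_spaceD(4)[OF P] by blast
      let ?C = "D' \<union> w' ` G"
      have "closedin X (w' ` G)"
        using \<open>finite G\<close> w'(1) clopenin_subset[OF VF(1)]
        by (intro priestley_space_closedin_finite[OF P]) auto
      then have "closedin X ?C"
        using CC_closedin[OF D'(1)] by (rule closedin_Un[rotated])
      moreover have "?C \<in> Chains r"
        using w'(2) below CC_comparable[OF D'(1)] unfolding Chains_def mem_Collect_eq by blast
      ultimately have CC: "?C \<in> CC X r"
        using CC_nonempty[OF D'(1)] by (simp add: CC_def)
      have "?C \<inter> W \<noteq> {}" if "W \<in> F" for W
        using that D'(4)[of W] w'(1)[of W] by blast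
      moreover have "?C \<subseteq> V"
        using D'(2) w'(1) by blast
      ultimately have "?C \<in> O'"
        using CC VF(5) unfolding CC_basic_def by blast
      moreover have "(?C, D') \<in> CC_order X r"
      proof (rule CC_orderI[OF CC D'(1)])
        fix x y assume "x \<in> D'" "y \<in> ?C" "(x, y) \<in> r"
        \<comment> \<open>An added point \<open>y\<close> lies below \<open>x\<close>, so
          \<open>(x, y) \<in> r\<close> forces \<open>y = x\<close>.\<close>
        then show "y \<in> D'"
          using below priestley_spaceD(5)[OF P, of x y] by blast
      qed blast
      ultimately show "D' \<in> CC_order X r `` O'"
        by blast
    qed
    ultimately show ?thesis
      by blast
  qed
  then show ?thesis
    by (subst openin_subopen) blast
qed

section \<open>From closed chains back to the base space\<close>

text \<open>Openness is pulled back along the map sending \<open>y\<close> to \<open>{y}\<close>;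
  closedness of the upset generated by \<open>V\<close> holds in every Priestley space.\<close>

lemma co_esakia_space_if_CC:
  assumes P: "priestley_space X r" and coE: "co_esakia_space (CC_topology X r) (CC_order X r)"
  shows "co_esakia_space X r"
  unfolding co_esakia_space_def
proof (intro conjI allI impI P)
  fix V assume V: "clopenin X V"
  have up: "openin (CC_topology X r) (CC_order X r `` CC_diamond X r V)"
    using coE clopenin_CC_box_diamond(2)[OF V] by (simp add: co_esakia_space_def clopenin_def)
  have finite_CC: "S \<in> CC X r" if "finite S" "S \<noteq> {}" "S \<subseteq> topspace X" "S \<in> Chains r" for S
    using that priestley_space_closedin_finite[OF P] by (simp add: CC_def)
  have "\<exists>N. openin X N \<and> y \<in> N \<and> N \<subseteq> r `` V" if y: "y \<in> r `` V" for y
  proof -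
    obtain v where v: "v \<in> V" "(v, y) \<in> r"
      using y by blast
    have top: "v \<in> topspace X" "y \<in> topspace X"
      using v priestley_spaceD(2)[OF P] by blast+
    have CC: "{v, y} \<in> CC X r" "{y} \<in> CC X r"
      using top v(2) priestley_spaceD(3)[OF P] by (auto intro!: finite_CC simp: Chains_def)
    have "({v, y}, {y}) \<in> CC_order X r"
    proof (rule CC_orderI[OF CC])
      fix a b assume "a \<in> {y}" "b \<in> {v, y}" "(a, b) \<in> r"
      then show "b \<in> {y}"
        using priestley_spaceD(5)[OF P v(2)] by blast
    qed blast
    moreover have "{v, y} \<in> CC_diamond X r V"
      using CC v by (simp add: CC_diamond_def)
    ultimately have "{y} \<in> CC_order X r `` CC_diamond X r V"
      by blast
    then obtain N F where NF: "clopenin X N" "finite F" "\<And>W. W \<in> F \<Longrightarrow> clopenin X W"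
      "{y} \<in> CC_basic X r N F" "CC_basic X r N F \<subseteq> CC_order X r `` CC_diamond X r V"
      using openin_CC_topology_basic[OF up] by metis
    \<comment> \<open>This intersection consists of the points whose singletons lie in the basic
      set.\<close>
    have "openin X (\<Inter>(insert N F))"
      using NF(1-3) by (intro openin_Inter) (auto simp: clopenin_def)
    moreover have "y \<in> \<Inter>(insert N F)"
      using NF(4) by (auto simp: CC_basic_def)
    moreover have "\<Inter>(insert N F) \<subseteq> r `` V"
    proof
      fix z assume z: "z \<in> \<Inter>(insert N F)"
      then have "z \<in> topspace X"
        using clopenin_subset[OF NF(1)] by blast
      then have "{z} \<in> CC X r"
        using priestley_spaceD(3)[OF P] by (intro finite_CC) (auto simp: Chains_def)
      then have "{z} \<in> CC_basic X r N F"
        using z by (auto simp: CC_basic_def)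
      then obtain C where C: "C \<in> CC_diamond X r V" "(C, {z}) \<in> CC_order X r"
        using NF(5) by blast
      then obtain u where u: "u \<in> C" "u \<in> V"
        by (auto simp: CC_diamond_def)
      note le = CC_orderD[OF C(2)]
      \<comment> \<open>If \<open>u\<close> lies above \<open>z\<close>, then \<open>u = z\<close>
        because \<open>{z}\<close> is an upset of \<open>C\<close>; otherwise comparability in
        \<open>C\<close> gives the claim.\<close>
      have "(u, z) \<in> r"
        using CC_comparable[OF le(1), of u z] le(3) le(4)[of z u] u(1)
          priestley_spaceD(3)[OF P \<open>z \<in> topspace X\<close>] by blast
      then show "z \<in> r `` V"
        using u(2) by blast
    qed
    ultimately show ?thesis
      by blast
  qed
  then have "openin X (r `` V)"
    by (subst openin_subopen) blast
  then show "clopenin X (r `` V)"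
    using priestley_space_closedin_upset[OF P, of V] V by (simp add: clopenin_def)
qed

theorem theorem5p6:
  fixes X :: "'a topology" and r :: "'a rel"
  assumes "priestley_space X r"
  shows "bi_esakia_space (CC_topology X r) (CC_order X r) \<longleftrightarrow> co_esakia_space X r"
proof
  assume "bi_esakia_space (CC_topology X r) (CC_order X r)"
  then show "co_esakia_space X r"
    using co_esakia_space_if_CC[OF assms] by (simp add: bi_esakia_space_def)
next
  assume "co_esakia_space X r"
  \<comment> \<open>The Priestley lemmas, applied to the space of chains, give closedness of upsets
    and downsets of clopen sets; openness comes from \<open>openin_CC_upset\<close> and
    \<open>openin_CC_downset\<close>.\<close>
  then show "bi_esakia_space (CC_topology X r) (CC_order X r)"
    using priestley_space_CC[OF assms] openin_CC_downset[OF assms] openin_CC_upset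
      priestley_space_closedin_downset priestley_space_closedin_upset
    unfolding bi_esakia_space_def esakia_space_def co_esakia_space_def clopenin_def by metis
qed

end
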